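(* Let $t>1$ be an integer and $r=2$. Then an efficient $(t,2)$ broadcast domination pattern for the infinite king's lattice is given by placing towers at every vertex of the form \[((2t-r)x-y,\; x+(2t-r)y),\qquad x,y\in\mathbb Z .\]
   Context: The infinite king's lattice is the graph with vertex set $\mathbb Z^2$ in which each vertex is adjacent to its eight horizontal, vertical and diagonal neighbors; $d$ is its graph distance. For a set $\mathbb T$ of vertices (towers of strength $t$), the signal received by a vertex $v$ is $f(v)=\sum_{w\in\mathbb T}\max\{0,\,t-d(v,w)\}$ (a tower also receives its own signal). The placement $\mathbb T$ is a $(t,r)$ broadcast domination pattern if $f(v)\ge r$ for every vertex $v$. The broadcast zone of a tower $w$ is $\{v: d(v,w)\le t-1\}$, and the overlap is the set of vertices lying in the broadcast zones of more than one tower. The pattern is efficient if every vertex in the overlap receives signal exactly $r$. *)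

theory Defs
  imports "HOL-Analysis.Infinite_Sum"
begin

type_synonym vertex = "int \<times> int"

definition king_edges :: "vertex rel" where
  "king_edges = {(u, v). u \<noteq> v \<and> \<bar>fst u - fst v\<bar> \<le> 1 \<and> \<bar>snd u - snd v\<bar> \<le> 1}"

text \<open>Graph distance: the least length of a walk. The lattice is connected, so such a walk
  always exists and the \<open>LEAST\<close> is attained; see \<open>king_dist_eq\<close> below.\<close>

definition king_dist :: "vertex \<Rightarrow> vertex \<Rightarrow> nat" where
  "king_dist u v = (LEAST n. (u, v) \<in> king_edges ^^ n)"

text \<open>Only the finitely many towers at distance less than \<open>t\<close> contribute, so this infinite sum
  is really a finite one; see \<open>signal_eq_sum\<close> below.\<close>

definition signal :: "int \<Rightarrow> vertex set \<Rightarrow> vertex \<Rightarrow> int" where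
  "signal t T v = (\<Sum>\<^sub>\<infinity>w\<in>T. max 0 (t - int (king_dist v w)))"

definition broadcast_domination_pattern :: "int \<Rightarrow> int \<Rightarrow> vertex set \<Rightarrow> bool" where
  "broadcast_domination_pattern t r T \<longleftrightarrow> (\<forall>v. signal t T v \<ge> r)"

definition broadcast_zone :: "int \<Rightarrow> vertex \<Rightarrow> vertex set" where
  "broadcast_zone t w = {v. int (king_dist v w) \<le> t - 1}"

definition overlap :: "int \<Rightarrow> vertex set \<Rightarrow> vertex set" where
  "overlap t T =
     {v. \<exists>w\<in>T. \<exists>w'\<in>T. w \<noteq> w' \<and> v \<in> broadcast_zone t w \<and> v \<in> broadcast_zone t w'}"

definition efficient_broadcast_domination_pattern :: "int \<Rightarrow> int \<Rightarrow> vertex set \<Rightarrow> bool" where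
  "efficient_broadcast_domination_pattern t r T \<longleftrightarrow>
     broadcast_domination_pattern t r T \<and> (\<forall>v \<in> overlap t T. signal t T v = r)"

lemma king_walk_bound:
  "(u, v) \<in> king_edges ^^ n \<Longrightarrow> \<bar>fst u - fst v\<bar> \<le> int n \<and> \<bar>snd u - snd v\<bar> \<le> int n"
proof (induction n arbitrary: v)
  case 0
  then show ?case by simp
next
  case (Suc n)
  then obtain w where "(u, w) \<in> king_edges ^^ n" and e: "(w, v) \<in> king_edges"
    by auto
  with Suc.IH have "\<bar>fst u - fst w\<bar> \<le> int n \<and> \<bar>snd u - snd w\<bar> \<le> int n" by blast
  moreover from e have "\<bar>fst w - fst v\<bar> \<le> 1 \<and> \<bar>snd w - snd v\<bar> \<le> 1"
    by (simp add: king_edges_def)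
  ultimately show ?case by linarith
qed

lemma king_walk_exists:
  "max \<bar>fst u - fst v\<bar> \<bar>snd u - snd v\<bar> = int n \<Longrightarrow> (u, v) \<in> king_edges ^^ n"
proof (induction n arbitrary: v)
  case 0
  then show ?case by (auto simp: prod_eq_iff)
next
  case (Suc n)
  define w where "w = (fst v + sgn (fst u - fst v), snd v + sgn (snd u - snd v))"
  have a: "max \<bar>fst u - fst w\<bar> \<bar>snd u - snd w\<bar> = int n"
    using Suc.prems by (auto simp: w_def sgn_if max_def abs_if split: if_splits)
  have b: "(w, v) \<in> king_edges"
    using Suc.prems by (auto simp: w_def king_edges_def sgn_if prod_eq_iff split: if_splits)
  from Suc.IH[OF a] b show ?case by auto
qed

lemma king_dist_eq:
  "int (king_dist u v) = max \<bar>fst u - fst v\<bar> \<bar>snd u - snd v\<bar>"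
proof -
  define n where "n = nat (max \<bar>fst u - fst v\<bar> \<bar>snd u - snd v\<bar>)"
  have n: "max \<bar>fst u - fst v\<bar> \<bar>snd u - snd v\<bar> = int n"
    by (simp add: n_def le_max_iff_disj)
  have "king_dist u v = n"
    unfolding king_dist_def
  proof (rule Least_equality)
    show "(u, v) \<in> king_edges ^^ n" by (rule king_walk_exists[OF n])
    show "n \<le> m" if "(u, v) \<in> king_edges ^^ m" for m
      using king_walk_bound[OF that] n by linarith
  qed
  with n show ?thesis by simp
qed

lemma finite_in_range: "finite {w. int (king_dist v w) < t}"
proof (rule finite_subset)
  show "{w. int (king_dist v w) < t} \<subseteq> {fst v - t..fst v + t} \<times> {snd v - t..snd v + t}"
    by (auto simp: king_dist_eq)
qed simp

lemma signal_eq_sum: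
  "signal t T v = (\<Sum>w | w \<in> T \<and> int (king_dist v w) < t. t - int (king_dist v w))"
proof -
  have fin: "finite {w. w \<in> T \<and> int (king_dist v w) < t}"
    by (rule finite_subset[OF _ finite_in_range[of v t]]) auto
  have "signal t T v =
      (\<Sum>\<^sub>\<infinity>w\<in>{w. w \<in> T \<and> int (king_dist v w) < t}. t - int (king_dist v w))"
    unfolding signal_def by (rule infsum_cong_neutral) auto
  with fin show ?thesis by simp
qed

end

(* Put n = t - 1 and m = 2 n, so the towers form the lattice spanned by (m,1) and (-1,m), an
   orthogonal basis whose vectors have squared Euclidean length m^2 + 1. Rounding the coordinates
   in this basis shows that every vertex is within distance n of some tower. A nonzero difference
   of towers whose maximum norm is at most m is plus or minus a basis vector, and then has maximum
   norm exactly m. Hence a vertex at distance less than n from a tower is in no other zone; and a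
   vertex at distance n from a tower is within n of at most one more tower, because the difference
   of two distinct vectors among the four shortest ones is not again one of them. Such a second
   tower exists, so every vertex of the overlap receives 1 + 1. *)

theory Submission
  imports Defs
begin

lemma int_sum_squares_le_1:
  fixes x y :: int
  assumes "x\<^sup>2 + y\<^sup>2 \<le> 1"
  shows "(x, y) \<in> {(0, 0), (1, 0), (-1, 0), (0, 1), (0, -1)}"
proof -
  have bound: "\<bar>z\<bar> \<le> 1" if "z\<^sup>2 \<le> 1" for z :: int
    using that abs_square_le_1 by blast
  have "x\<^sup>2 \<le> 1" "y\<^sup>2 \<le> 1"
    using assms zero_le_power2[of x] zero_le_power2[of y] by linarith+
  then have "\<bar>x\<bar> \<le> 1" "\<bar>y\<bar> \<le> 1"
    by (simp_all add: bound)
  then have "x \<in> {-1, 0, 1}" "y \<in> {-1, 0, 1}"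
    by auto
  with assms show ?thesis by auto
qed

text \<open>The product of the Gaussian integers \<open>m + i\<close> and \<open>x + y i\<close>,
  read as a vertex.\<close>

definition lattice_point :: "int \<Rightarrow> int \<Rightarrow> int \<Rightarrow> vertex" where
  "lattice_point m x y = (m * x - y, x + m * y)"

text \<open>Norms of Gaussian integers multiply, so the squared length is
  \<open>m\<^sup>2 + 1\<close> times \<open>x\<^sup>2 + y\<^sup>2\<close>; as it is at most
  \<open>2 * m\<^sup>2\<close>, the second factor is below 2.\<close>

lemma short_lattice_vector:
  fixes m x y :: int
  assumes "\<bar>m * x - y\<bar> \<le> m" and "\<bar>x + m * y\<bar> \<le> m"
  shows "(x, y) \<in> {(0, 0), (1, 0), (-1, 0), (0, 1), (0, -1)}"
proof (rule int_sum_squares_le_1, rule ccontr)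
  assume "\<not> x\<^sup>2 + y\<^sup>2 \<le> 1"
  then have "(m\<^sup>2 + 1) * 2 \<le> (m\<^sup>2 + 1) * (x\<^sup>2 + y\<^sup>2)"
    by (intro mult_left_mono) auto
  also have "\<dots> = (m * x - y)\<^sup>2 + (x + m * y)\<^sup>2"
    by (simp add: power2_eq_square algebra_simps)
  also have "\<dots> \<le> m\<^sup>2 + m\<^sup>2"
    using assms by (intro add_mono abs_le_square_iff[THEN iffD1]) auto
  finally show False by simp
qed

text \<open>Two nonzero vectors of the list differ by a vector of even coordinate sum, and the only
  such vector in the list is zero. This excludes a third tower in range.\<close>

lemma unit_vector_difference:
  fixes i j p q :: int
  assumes "(i, j) \<in> {(1, 0), (-1, 0), (0, 1), (0, -1)}"
    and "(p, q) \<in> {(0, 0), (1, 0), (-1, 0), (0, 1), (0, -1)}"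
    and "(p - i, q - j) \<in> {(0, 0), (1, 0), (-1, 0), (0, 1), (0, -1)}"
  shows "(p, q) = (0, 0) \<or> (p, q) = (i, j)"
  using assms(2,1,3) by (elim insertE emptyE; simp)

lemma near_lattice_point_exists:
  fixes n a b :: int
  assumes "n \<ge> 0"
  shows "\<exists>x y. \<bar>a - (2 * n * x - y)\<bar> \<le> n \<and> \<bar>b - (x + 2 * n * y)\<bar> \<le> n"
proof -
  \<comment> \<open>\<open>D\<close> is the common denominator of the coordinates
    \<open>(2 * n * a + b) / D\<close> and \<open>(2 * n * b - a) / D\<close> of
    \<open>(a, b)\<close> in the basis of the lattice.\<close>
  define D where "D = 4 * n\<^sup>2 + 1"
  have Dpos: "D > 0" by (simp add: D_def add_nonneg_pos)
  \<comment> \<open>Since \<open>D\<close> is odd with half \<open>2 * n\<^sup>2\<close>, shifting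
    by that amount turns \<open>div\<close> into rounding to the nearest integer.\<close>
  have round: "\<exists>x. \<bar>p - D * x\<bar> \<le> 2 * n\<^sup>2" for p
  proof
    have "(p + 2 * n\<^sup>2) = D * ((p + 2 * n\<^sup>2) div D) + (p + 2 * n\<^sup>2) mod D"
      by simp
    moreover have "0 \<le> (p + 2 * n\<^sup>2) mod D" "(p + 2 * n\<^sup>2) mod D < D"
      using Dpos by simp_all
    ultimately show "\<bar>p - D * ((p + 2 * n\<^sup>2) div D)\<bar> \<le> 2 * n\<^sup>2"
      unfolding D_def by linarith
  qed
  obtain x where x: "\<bar>2 * n * a + b - D * x\<bar> \<le> 2 * n\<^sup>2"
    using round by blast
  obtain y where y: "\<bar>2 * n * b - a - D * y\<bar> \<le> 2 * n\<^sup>2"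
    using round by blast
  define p where "p = 2 * n * a + b - D * x"
  define q where "q = 2 * n * b - a - D * y"
  have bound: "\<bar>c\<bar> \<le> n"
    if "D * c = 2 * n * p' + q'" "\<bar>p'\<bar> \<le> 2 * n\<^sup>2" "\<bar>q'\<bar> \<le> 2 * n\<^sup>2" for c p' q'
  proof -
    have "\<bar>2 * n * p'\<bar> \<le> 2 * n * (2 * n\<^sup>2)"
      unfolding abs_mult using that(2) assms by (intro mult_mono) auto
    then have "D * \<bar>c\<bar> \<le> 2 * n * (2 * n\<^sup>2) + 2 * n\<^sup>2"
      using that(1,3) Dpos by (simp add: abs_mult[symmetric] abs_if split: if_splits)
    \<comment> \<open>The bound on \<open>\<bar>c\<bar>\<close> may exceed \<open>n\<close>, but by
      less than 1, so integrality of \<open>c\<close> closes the gap.\<close>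
    also have "\<dots> < D * (n + 1)"
    proof -
      have "D * (n + 1) = 2 * n * (2 * n\<^sup>2) + 2 * n\<^sup>2 + (2 * n\<^sup>2 + n + 1)"
        by (simp add: D_def algebra_simps power2_eq_square)
      moreover have "2 * n\<^sup>2 + n + 1 > 0"
        using assms by (intro add_nonneg_pos add_nonneg_nonneg) auto
      ultimately show ?thesis by linarith
    qed
    finally show ?thesis
      using Dpos by (simp add: mult_less_cancel_left)
  qed
  have "\<bar>a - (2 * n * x - y)\<bar> \<le> n"
  proof (rule bound)
    show "D * (a - (2 * n * x - y)) = 2 * n * p + (- q)"
      by (simp add: p_def q_def D_def algebra_simps power2_eq_square)
  qed (use x y in \<open>simp_all add: p_def q_def\<close>)
  moreover have "\<bar>b - (x + 2 * n * y)\<bar> \<le> n"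
  proof (rule bound)
    show "D * (b - (x + 2 * n * y)) = 2 * n * q + p"
      by (simp add: p_def q_def D_def algebra_simps power2_eq_square)
  qed (use x y in \<open>simp_all add: p_def q_def\<close>)
  ultimately show ?thesis by blast
qed

lemma second_tower_exists:
  fixes n a b :: int
  assumes "n \<ge> 1" and "max \<bar>a\<bar> \<bar>b\<bar> = n"
  shows "\<exists>x y. (x, y) \<noteq> (0, 0) \<and> max \<bar>a - (2 * n * x - y)\<bar> \<bar>b - (x + 2 * n * y)\<bar> = n"
proof -
  \<comment> \<open>The neighbouring zones meet the square around the origin in a pinwheel: each is
    shifted by 1 along its side and misses one corner, which the next side covers.\<close>
  consider (right) "a = n" "b > - n" | (left) "a = - n" "b < n"
    | (up) "b = n" "a < n" | (down) "b = - n" "a > - n"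
    using assms by linarith
  then show ?thesis
  proof cases
    case right
    then show ?thesis using assms by (intro exI[of _ 1] exI[of _ 0]) auto
  next
    case left
    then show ?thesis using assms by (intro exI[of _ "-1"] exI[of _ 0]) auto
  next
    case up
    then show ?thesis using assms by (intro exI[of _ 0] exI[of _ 1]) auto
  next
    case down
    then show ?thesis using assms by (intro exI[of _ 0] exI[of _ "-1"]) auto
  qed
qed

text \<open>With \<open>n = t - 1\<close>, the first case gives a signal of at least 2 outside the
  overlap, the second exactly 1 + 1.\<close>

lemma towers_in_range:
  fixes n :: int and v :: vertex
  assumes n: "n \<ge> 1"
  defines "R \<equiv> {w \<in> range (case_prod (lattice_point (2 * n))). int (king_dist v w) \<le> n}"
  shows "(\<exists>w. R = {w} \<and> int (king_dist v w) < n) \<or>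
    (\<exists>w w'. w \<noteq> w' \<and> R = {w, w'} \<and> int (king_dist v w) = n \<and> int (king_dist v w') = n)"
proof -
  let ?L = "lattice_point (2 * n)"
  obtain a b where v: "v = (a, b)" by fastforce
  have dist: "int (king_dist v (?L x y)) = max \<bar>a - (2 * n * x - y)\<bar> \<bar>b - (x + 2 * n * y)\<bar>" for x y
    by (simp add: king_dist_eq v lattice_point_def)
  have diff: "(x' - x, y' - y) \<in> {(0, 0), (1, 0), (-1, 0), (0, 1), (0, -1)}"
    if "int (king_dist v (?L x y)) \<le> n" "int (king_dist v (?L x' y')) \<le> n" for x y x' y'
  proof (rule short_lattice_vector[of "2 * n"])
    \<comment> \<open>Triangle inequality through \<open>v\<close>.\<close>
    show "\<bar>2 * n * (x' - x) - (y' - y)\<bar> \<le> 2 * n" "\<bar>x' - x + 2 * n * (y' - y)\<bar> \<le> 2 * n"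
      using that unfolding dist max.bounded_iff right_diff_distrib by linarith+
  qed
  have R: "R = {?L x y | x y. int (king_dist v (?L x y)) \<le> n}"
    unfolding R_def by force
  obtain x y where xy: "int (king_dist v (?L x y)) \<le> n"
    using near_lattice_point_exists[of n a b] n by (auto simp: dist)
  show ?thesis
  proof (cases "int (king_dist v (?L x y)) < n")
    case True
    have "?L x' y' = ?L x y" if "int (king_dist v (?L x' y')) \<le> n" for x' y'
    proof -
      \<comment> \<open>One strict distance makes the difference shorter than \<open>2 * n\<close>,
        which every basis vector attains.\<close>
      have "\<bar>2 * n * (x' - x) - (y' - y)\<bar> < 2 * n" "\<bar>x' - x + 2 * n * (y' - y)\<bar> < 2 * n"
        using that True unfolding dist max.bounded_iff max_less_iff_conj right_diff_distrib
        by linarith+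
      with diff[OF xy that] have "x' - x = 0 \<and> y' - y = 0" by auto
      then show ?thesis by simp
    qed
    with xy have "R = {?L x y}" unfolding R by blast
    with True show ?thesis by blast
  next
    case False
    with xy have eq: "int (king_dist v (?L x y)) = n" by simp
    obtain i j where ij: "(i, j) \<noteq> (0, 0)"
      and "max \<bar>a - (2 * n * x - y) - (2 * n * i - j)\<bar> \<bar>b - (x + 2 * n * y) - (i + 2 * n * j)\<bar> = n"
      using second_tower_exists[OF n eq[unfolded dist]] by blast
    then have eq': "int (king_dist v (?L (x + i) (y + j))) = n"
      unfolding dist by (simp add: algebra_simps)
    have short: "(i, j) \<in> {(1, 0), (-1, 0), (0, 1), (0, -1)}"
      using diff[of x y "x + i" "y + j"] eq eq' ij by auto
    then have neq: "?L x y \<noteq> ?L (x + i) (y + j)"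
      using n by (auto simp: lattice_point_def algebra_simps)
    have "?L x' y' \<in> {?L x y, ?L (x + i) (y + j)}"
      if near: "int (king_dist v (?L x' y')) \<le> n" for x' y'
    proof -
      have "(x' - x, y' - y) \<in> {(0, 0), (1, 0), (-1, 0), (0, 1), (0, -1)}"
        using diff[OF xy near] .
      \<comment> \<open>The candidate is compared with the second tower as well as with the
        first.\<close>
      moreover have "(x' - x - i, y' - y - j) \<in> {(0, 0), (1, 0), (-1, 0), (0, 1), (0, -1)}"
        using diff[OF _ near, of "x + i" "y + j"] eq' by (simp add: algebra_simps)
      ultimately have "(x' - x, y' - y) = (0, 0) \<or> (x' - x, y' - y) = (i, j)"
        by (rule unit_vector_difference[OF short])
      then have "x' = x \<and> y' = y \<or> x' = x + i \<and> y' = y + j"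
        unfolding prod.inject by linarith
      then show ?thesis by auto
    qed
    then have "R = {?L x y, ?L (x + i) (y + j)}"
      using eq[THEN eq_refl] eq'[THEN eq_refl] unfolding R by blast
    with eq eq' neq show ?thesis by blast
  qed
qed

theorem theorem5p5:
  fixes t r :: int
  assumes "t > 1" and "r = 2"
  shows "efficient_broadcast_domination_pattern t r
           {((2 * t - r) * x - y, x + (2 * t - r) * y) | x y :: int. True}"
proof -
  define T where "T = range (case_prod (lattice_point (2 * (t - 1))))"
  have T: "{((2 * t - r) * x - y, x + (2 * t - r) * y) | x y :: int. True} = T"
    using \<open>r = 2\<close> by (auto simp: T_def lattice_point_def image_def)
  have "signal t T v \<ge> r \<and> (v \<in> overlap t T \<longrightarrow> signal t T v = r)" for v
  proof -
    define R where "R = {w \<in> T. int (king_dist v w) \<le> t - 1}"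
    have sig: "signal t T v = (\<Sum>w\<in>R. t - int (king_dist v w))"
      unfolding signal_eq_sum R_def by (rule sum.cong) auto
    have ov: "v \<in> overlap t T \<longleftrightarrow> (\<exists>w\<in>R. \<exists>w'\<in>R. w \<noteq> w')"
      unfolding overlap_def broadcast_zone_def R_def by blast
    have "t - 1 \<ge> 1" using \<open>t > 1\<close> by simp
    from towers_in_range[OF this, of v] consider
        (one) w where "R = {w}" "int (king_dist v w) < t - 1"
      | (two) w w' where "w \<noteq> w'" "R = {w, w'}"
          "int (king_dist v w) = t - 1" "int (king_dist v w') = t - 1"
      unfolding R_def T_def by blast
    then show ?thesis
    proof cases
      \<comment> \<open>The integer distance is at most \<open>t - 2\<close>, and a singleton
        \<open>R\<close> keeps \<open>v\<close> out of the overlap.\<close>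
      case one
      with \<open>r = 2\<close> show ?thesis by (simp add: sig ov)
    next
      case two
      with \<open>r = 2\<close> show ?thesis by (simp add: sig)
    qed
  qed
  then show ?thesis
    unfolding T efficient_broadcast_domination_pattern_def broadcast_domination_pattern_def by blast
qed

end
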